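(* Let $W$ be a finite Weyl group (of an irreducible root system) with longest element $w_0$, and let $\lambda\in P^+$ be a dominant integral weight. Then $\mathscr{L}_\lambda(w)\leq\mathscr{L}_\lambda(w_0)$ for all $w\in W$.
   Context: $\Phi$ is an irreducible reduced crystallographic root system in a Euclidean space $V$ (spanned by $\Phi$) with inner product $(\cdot\mid\cdot)$, simple roots $\alpha_1,\dots,\alpha_n$ and Weyl group $W$ generated by the simple reflections $s_i=s_{\alpha_i}$; $w_0$ is the unique element of maximal Coxeter length. For a root $\alpha$, the coroot $\alpha^\vee$ is the linear form $\langle x,\alpha^\vee\rangle=2(\alpha\mid x)/(\alpha\mid\alpha)$. The fundamental weights $\omega_1,\dots,\omega_n\in V$ satisfy $\langle\omega_i,\alpha_j^\vee\rangle=\delta_{ij}$, and $P^+=\bigoplus_{i=1}^n\mathbb{N}\omega_i$ is the set of dominant integral weights ($\mathbb{N}$ includes $0$). $\rho^\vee$ (the sum of the fundamental coweights) is the linear form on $V$ with $\langle\alpha_i,\rho^\vee\rangle=1$ for all $1\le i\le n$. For $\lambda\in P^+$ and $w\in W$, the $\lambda$-atomic length is $\mathscr{L}_\lambda(w)=\langle\lambda-w(\lambda),\rho^\vee\rangle$, which is a nonnegative integer. *)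

theory Defs
  imports "HOL-Analysis.Analysis" "HOL-Algebra.Bij" "HOL-Algebra.Generated_Groups"
begin

section \<open>Root systems\<close>

text \<open>
  The Euclidean space \<open>V\<close> is an arbitrary type of class \<open>euclidean_space\<close>, and \<open>V\<close> is the whole
  type, so that a root system has to span \<open>UNIV\<close>. Linear forms on \<open>V\<close> are functions \<open>V \<Rightarrow> real\<close>
  and elements of the Weyl group are functions \<open>V \<Rightarrow> V\<close>.
\<close>

definition coroot :: "'a::euclidean_space \<Rightarrow> 'a \<Rightarrow> real" where
  "coroot a x = 2 * (a \<bullet> x) / (a \<bullet> a)"

definition reflection :: "'a::euclidean_space \<Rightarrow> 'a \<Rightarrow> 'a" where
  "reflection a x = x - coroot a x *\<^sub>R a"

definition root_system :: "'a::euclidean_space set \<Rightarrow> bool" where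
  "root_system \<Phi> \<longleftrightarrow> finite \<Phi> \<and> 0 \<notin> \<Phi> \<and> span \<Phi> = UNIV \<and>
     (\<forall>a\<in>\<Phi>. reflection a ` \<Phi> = \<Phi>)"

definition crystallographic :: "'a::euclidean_space set \<Rightarrow> bool" where
  "crystallographic \<Phi> \<longleftrightarrow> (\<forall>a\<in>\<Phi>. \<forall>b\<in>\<Phi>. coroot a b \<in> \<int>)"

definition reduced_roots :: "'a::euclidean_space set \<Rightarrow> bool" where
  "reduced_roots \<Phi> \<longleftrightarrow> (\<forall>a\<in>\<Phi>. \<forall>c. c *\<^sub>R a \<in> \<Phi> \<longrightarrow> c = 1 \<or> c = -1)"

definition irreducible_roots :: "'a::euclidean_space set \<Rightarrow> bool" where
  "irreducible_roots \<Phi> \<longleftrightarrow> \<Phi> \<noteq> {} \<and>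
     \<not> (\<exists>A B. A \<noteq> {} \<and> B \<noteq> {} \<and> A \<union> B = \<Phi> \<and> A \<inter> B = {} \<and> (\<forall>a\<in>A. \<forall>b\<in>B. a \<bullet> b = 0))"

text \<open>The simple roots are \<open>\<alpha> 1, \<dots>, \<alpha> n\<close>; values of \<open>\<alpha>\<close> outside \<open>{1..n}\<close> are irrelevant.\<close>

definition simple_roots :: "'a::euclidean_space set \<Rightarrow> nat \<Rightarrow> (nat \<Rightarrow> 'a) \<Rightarrow> bool" where
  "simple_roots \<Phi> n \<alpha> \<longleftrightarrow>
     inj_on \<alpha> {1..n} \<and> \<alpha> ` {1..n} \<subseteq> \<Phi> \<and>
     independent (\<alpha> ` {1..n}) \<and> span (\<alpha> ` {1..n}) = UNIV \<and>
     (\<forall>b\<in>\<Phi>. \<exists>k :: nat \<Rightarrow> int. b = (\<Sum>i=1..n. of_int (k i) *\<^sub>R \<alpha> i) \<and>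
        ((\<forall>i\<in>{1..n}. k i \<ge> 0) \<or> (\<forall>i\<in>{1..n}. k i \<le> 0)))"

section \<open>The Weyl group\<close>

definition weyl_group :: "nat \<Rightarrow> (nat \<Rightarrow> 'a::euclidean_space) \<Rightarrow> ('a \<Rightarrow> 'a) set" where
  "weyl_group n \<alpha> = generate (BijGroup UNIV) ((\<lambda>i. reflection (\<alpha> i)) ` {1..n})"

definition word_prod :: "(nat \<Rightarrow> 'a::euclidean_space) \<Rightarrow> nat list \<Rightarrow> 'a \<Rightarrow> 'a" where
  "word_prod \<alpha> is = foldr (\<lambda>i f. reflection (\<alpha> i) \<circ> f) is id"

definition coxeter_length :: "nat \<Rightarrow> (nat \<Rightarrow> 'a::euclidean_space) \<Rightarrow> ('a \<Rightarrow> 'a) \<Rightarrow> nat" where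
  "coxeter_length n \<alpha> w =
     (LEAST l. \<exists>is. set is \<subseteq> {1..n} \<and> length is = l \<and> word_prod \<alpha> is = w)"

text \<open>
  Uniqueness of the longest element is a theorem, hence not part of the definition.
\<close>

definition longest_element ::
    "nat \<Rightarrow> (nat \<Rightarrow> 'a::euclidean_space) \<Rightarrow> ('a \<Rightarrow> 'a) \<Rightarrow> bool" where
  "longest_element n \<alpha> w0 \<longleftrightarrow> w0 \<in> weyl_group n \<alpha> \<and>
     (\<forall>w\<in>weyl_group n \<alpha>. coxeter_length n \<alpha> w \<le> coxeter_length n \<alpha> w0)"

section \<open>Weights and atomic length\<close>

text \<open>
  The two definite descriptions below denote as soon as \<open>\<alpha> 1, \<dots>, \<alpha> n\<close> is a basis of \<open>V\<close>;
  see the lemmas \<open>fundamental_weight_ex1\<close> and \<open>rho_check_ex1\<close>.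
\<close>

definition fundamental_weight :: "nat \<Rightarrow> (nat \<Rightarrow> 'a::euclidean_space) \<Rightarrow> nat \<Rightarrow> 'a" where
  "fundamental_weight n \<alpha> i =
     (THE x. \<forall>j\<in>{1..n}. coroot (\<alpha> j) x = (if i = j then 1 else 0))"

definition dominant_weights :: "nat \<Rightarrow> (nat \<Rightarrow> 'a::euclidean_space) \<Rightarrow> 'a set" where
  "dominant_weights n \<alpha> =
     {\<Sum>i=1..n. of_nat (c i) *\<^sub>R fundamental_weight n \<alpha> i | c :: nat \<Rightarrow> nat. True}"

definition rho_check :: "nat \<Rightarrow> (nat \<Rightarrow> 'a::euclidean_space) \<Rightarrow> 'a \<Rightarrow> real" where
  "rho_check n \<alpha> = (THE f. linear f \<and> (\<forall>i\<in>{1..n}. f (\<alpha> i) = 1))"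

definition atomic_length ::
    "nat \<Rightarrow> (nat \<Rightarrow> 'a::euclidean_space) \<Rightarrow> 'a \<Rightarrow> ('a \<Rightarrow> 'a) \<Rightarrow> real" where
  "atomic_length n \<alpha> lam w = rho_check n \<alpha> (lam - w lam)"

section \<open>Well-definedness\<close>

lemma rho_check_ex1:
  fixes \<alpha> :: "nat \<Rightarrow> 'a::euclidean_space"
  assumes "simple_roots \<Phi> n \<alpha>"
  shows "\<exists>!f. linear f \<and> (\<forall>i\<in>{1..n}. f (\<alpha> i) = (1::real))"
proof -
  let ?B = "\<alpha> ` {1..n}"
  have ind: "independent ?B" and sp: "span ?B = UNIV"
    using assms by (auto simp: simple_roots_def)
  obtain f where f: "linear f" "\<forall>x\<in>?B. f x = (1::real)"
    using linear_independent_extend[OF ind, of "\<lambda>_. 1"] by auto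
  show ?thesis
  proof (rule ex1I[of _ f])
    show "linear f \<and> (\<forall>i\<in>{1..n}. f (\<alpha> i) = 1)" using f by auto
  next
    fix g assume g: "linear g \<and> (\<forall>i\<in>{1..n}. g (\<alpha> i) = (1::real))"
    show "g = f"
    proof
      fix x
      show "g x = f x"
        by (rule linear_eq_on[of g f x ?B]) (use f g sp in auto)
    qed
  qed
qed

lemma rho_check_spec:
  assumes "simple_roots \<Phi> n \<alpha>"
  shows "linear (rho_check n \<alpha>)" and "i \<in> {1..n} \<Longrightarrow> rho_check n \<alpha> (\<alpha> i) = 1"
  using theI'[OF rho_check_ex1[OF assms]] unfolding rho_check_def[symmetric] by auto

lemma fundamental_weight_ex1:
  fixes \<alpha> :: "nat \<Rightarrow> 'a::euclidean_space"
  assumes "simple_roots \<Phi> n \<alpha>"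
  shows "\<exists>!x. \<forall>j\<in>{1..n}. coroot (\<alpha> j) x = (if i = j then 1 else 0)"
proof -
  let ?B = "\<alpha> ` {1..n}"
  have ind: "independent ?B" and sp: "span ?B = UNIV" and inj: "inj_on \<alpha> {1..n}"
    using assms by (auto simp: simple_roots_def)
  have nz: "\<alpha> j \<noteq> 0" if "j \<in> {1..n}" for j
    using ind that dependent_zero[of ?B] by (metis imageI)
  obtain f :: "'a \<Rightarrow> real" where f: "linear f"
      "\<forall>x\<in>?B. f x = (if i \<in> {1..n} \<and> x = \<alpha> i then (x \<bullet> x) / 2 else 0)"
    using linear_independent_extend[OF ind, of "\<lambda>x. if i \<in> {1..n} \<and> x = \<alpha> i then (x \<bullet> x) / 2 else 0"]
    by auto
  define v where "v = adjoint f 1"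
  have v: "y \<bullet> v = f y" for y
    using adjoint_works[OF f(1), of y 1] by (simp add: v_def inner_commute)
  show ?thesis
  proof (rule ex1I[of _ v])
    show "\<forall>j\<in>{1..n}. coroot (\<alpha> j) v = (if i = j then 1 else 0)"
    proof
      fix j assume j: "j \<in> {1..n}"
      have "i \<in> {1..n} \<and> \<alpha> j = \<alpha> i \<longleftrightarrow> i = j" using inj j by (auto dest: inj_onD)
      then have "f (\<alpha> j) = (if i = j then (\<alpha> j \<bullet> \<alpha> j) / 2 else 0)"
        using bspec[OF f(2) imageI[OF j]] by simp
      then show "coroot (\<alpha> j) v = (if i = j then 1 else 0)"
        using nz[OF j] by (simp add: coroot_def v)
    qed
  next
    fix y assume y: "\<forall>j\<in>{1..n}. coroot (\<alpha> j) y = (if i = j then 1 else 0)"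
    have eq: "\<alpha> j \<bullet> y = f (\<alpha> j)" if j: "j \<in> {1..n}" for j
    proof -
      have "i \<in> {1..n} \<and> \<alpha> j = \<alpha> i \<longleftrightarrow> i = j" using inj j by (auto dest: inj_onD)
      then have "f (\<alpha> j) = (if i = j then (\<alpha> j \<bullet> \<alpha> j) / 2 else 0)"
        using bspec[OF f(2) imageI[OF j]] by simp
      moreover have "2 * (\<alpha> j \<bullet> y) / (\<alpha> j \<bullet> \<alpha> j) = (if i = j then 1 else 0)"
        using y j by (auto simp: coroot_def)
      ultimately show ?thesis using nz[OF j] by (auto simp: field_simps split: if_splits)
    qed
    have "z \<bullet> y = z \<bullet> v" for z
      unfolding v
    proof (rule linear_eq_on[of "\<lambda>z. z \<bullet> y" f z ?B])
      show "linear (\<lambda>z. z \<bullet> y)"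
        by (rule bounded_linear.linear[OF bounded_linear_inner_left])
      show "b \<bullet> y = f b" if "b \<in> ?B" for b using that eq by blast
    qed (use f(1) sp in simp_all)
    then show "y = v" by (metis vector_eq_ldot)
  qed
qed

lemma fundamental_weight_spec:
  assumes "simple_roots \<Phi> n \<alpha>" "j \<in> {1..n}"
  shows "coroot (\<alpha> j) (fundamental_weight n \<alpha> i) = (if i = j then 1 else 0)"
  using theI'[OF fundamental_weight_ex1[OF assms(1), of i]] assms(2)
  unfolding fundamental_weight_def[symmetric] by auto

end

theory Submission imports Defs
begin

text \<open>
  Write \<open>f\<close> for \<open>\<rho>\<^sup>\<or>\<close>; a root is positive iff \<open>f\<close> is positive on it. By the exchange condition,
  the longest element \<open>w\<^sub>0\<close> satisfies \<open>f (w\<^sub>0\<inverse> \<alpha>\<^sub>i) < 0\<close> for all \<open>i\<close>, so \<open>\<mu> = w\<^sub>0 \<lambda>\<close> is antidominant.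
  For antidominant \<open>\<mu>\<close> one has \<open>f \<mu> \<le> f (v \<mu>)\<close> for all \<open>v \<in> W\<close>, by induction on the length of \<open>v\<close>:
  if \<open>v = v' s\<^sub>j\<close> is reduced, then \<open>v \<mu>\<close> is \<open>v' \<mu>\<close> plus a nonnegative multiple of the positive root
  \<open>v' \<alpha>\<^sub>j\<close>. Apply this to \<open>v = w w\<^sub>0\<inverse>\<close>.
\<close>

section \<open>Reflections and words\<close>

lemma linear_reflection: "linear (reflection a)"
  by (rule linearI)
    (simp_all add: reflection_def coroot_def inner_add_right add_divide_distrib algebra_simps)

lemma reflection_inner_reflection [simp]: "reflection a x \<bullet> reflection a y = x \<bullet> y"
  by (cases "a = 0")
    (simp_all add: reflection_def coroot_def inner_diff_left inner_diff_right inner_commute)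

lemma reflection_reflection [simp]: "reflection a (reflection a x) = x"
  by (cases "a = 0")
    (simp_all add: reflection_def coroot_def inner_diff_right)

lemma reflection_self: "a \<noteq> 0 \<Longrightarrow> reflection a a = - a"
  by (simp add: reflection_def coroot_def scaleR_2)

text \<open>Since \<open>reflection a\<close> is a linear isometry, it transports the formula for
  the reflection in b to that for the reflection in its image. \<open>exchange\<close> uses this to
  move a reflection past a letter of a word.\<close>

lemma reflection_conjugate:
  "reflection (reflection a b) (reflection a x) = reflection a (reflection b x)"
  by (simp add: reflection_def[of "reflection a b"] reflection_def[of b] coroot_def
      linear_diff[OF linear_reflection] linear_scale[OF linear_reflection])

lemma word_prod_Nil [simp]: "word_prod \<alpha> [] = id"
  by (simp add: word_prod_def)

lemma word_prod_Cons [simp]: "word_prod \<alpha> (i # is) = reflection (\<alpha> i) \<circ> word_prod \<alpha> is"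
  by (simp add: word_prod_def)

lemma word_prod_append [simp]: "word_prod \<alpha> (is @ js) = word_prod \<alpha> is \<circ> word_prod \<alpha> js"
  by (induction "is") (simp_all add: comp_assoc)

lemma linear_word_prod: "linear (word_prod \<alpha> is)"
proof (induction "is")
  case Nil
  then show ?case by (simp only: word_prod_Nil linear_id)
next
  case (Cons i "is")
  then show ?case by (simp only: word_prod_Cons linear_compose linear_reflection)
qed

lemma word_prod_rev_word_prod [simp]: "word_prod \<alpha> (rev is) (word_prod \<alpha> is x) = x"
  by (induction "is" arbitrary: x) simp_all

lemma word_prod_word_prod_rev [simp]: "word_prod \<alpha> is (word_prod \<alpha> (rev is) x) = x"
  using word_prod_rev_word_prod[of \<alpha> "rev is"] by simp

text \<open>A word acts by an isometry whose inverse is the reversed word, so its adjoint is the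
  reversed word too.\<close>

lemma inner_word_prod: "x \<bullet> word_prod \<alpha> is y = word_prod \<alpha> (rev is) x \<bullet> y"
proof -
  have "word_prod \<alpha> is u \<bullet> word_prod \<alpha> is v = u \<bullet> v" for u v
    by (induction "is") simp_all
  from this[of "word_prod \<alpha> (rev is) x" y] show ?thesis by simp
qed

section \<open>The Weyl group as the set of products of simple reflections\<close>

lemma bij_reflection: "bij (reflection a)"
  by (rule involuntory_imp_bij) simp

lemma reflection_in_Bij: "reflection a \<in> carrier (BijGroup UNIV)"
  by (simp add: BijGroup_def Bij_def bij_reflection)

text \<open>The product of \<open>BijGroup\<close> is restricted to its carrier, hence the
  membership premises; restricting functions to \<open>UNIV\<close> changes nothing.\<close>

lemma mult_BijGroup_UNIV:
  "\<lbrakk>g \<in> carrier (BijGroup UNIV); h \<in> carrier (BijGroup UNIV)\<rbrakk> \<Longrightarrow> g \<otimes>\<^bsub>BijGroup UNIV\<^esub> h = g \<circ> h"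
  by (auto simp: BijGroup_def compose_def)

lemma one_BijGroup_UNIV: "\<one>\<^bsub>BijGroup UNIV\<^esub> = id"
  by (auto simp: BijGroup_def)

lemma inv_reflection: "inv\<^bsub>BijGroup UNIV\<^esub> (reflection a) = reflection a"
  by (rule group.inv_equality[OF group_BijGroup])
    (auto simp: mult_BijGroup_UNIV reflection_in_Bij one_BijGroup_UNIV)

lemma word_prod_in_Bij: "word_prod \<alpha> is \<in> carrier (BijGroup UNIV)"
proof -
  have "bij (word_prod \<alpha> is)"
    by (rule bij_betw_byWitness[where f' = "word_prod \<alpha> (rev is)"]) simp_all
  then show ?thesis by (simp add: BijGroup_def Bij_def)
qed

text \<open>Words suffice because each generator is its own inverse.\<close>

lemma weyl_group_eq: "weyl_group n \<alpha> = {word_prod \<alpha> is | is. set is \<subseteq> {1..n}}"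
proof (intro equalityI subsetI)
  fix w assume "w \<in> weyl_group n \<alpha>"
  then show "w \<in> {word_prod \<alpha> is | is. set is \<subseteq> {1..n}}"
    unfolding weyl_group_def
  proof (induction rule: generate.induct)
    case one
    then show ?case by (auto simp: one_BijGroup_UNIV intro!: exI[of _ "[]"])
  next
    case (incl h)
    then obtain i where "i \<in> {1..n}" "h = reflection (\<alpha> i)" by auto
    then show ?case by (auto intro!: exI[of _ "[i]"])
  next
    case (inv h)
    then obtain i where "i \<in> {1..n}" "h = reflection (\<alpha> i)" by auto
    then show ?case by (auto simp: inv_reflection intro!: exI[of _ "[i]"])
  next
    case (eng h1 h2)
    then obtain "is" js where "set is \<subseteq> {1..n}" "h1 = word_prod \<alpha> is"
      "set js \<subseteq> {1..n}" "h2 = word_prod \<alpha> js" by auto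
    then show ?case
      by (intro CollectI exI[of _ "is @ js"]) (simp add: mult_BijGroup_UNIV word_prod_in_Bij)
  qed
next
  fix w assume "w \<in> {word_prod \<alpha> is | is. set is \<subseteq> {1..n}}"
  then obtain "is" where "set is \<subseteq> {1..n}" "w = word_prod \<alpha> is" by auto
  moreover have "word_prod \<alpha> is \<in> weyl_group n \<alpha>" if "set is \<subseteq> {1..n}"
    using that
  proof (induction "is")
    case Nil
    then show ?case
      using generate.one[of "BijGroup UNIV"] by (simp only: weyl_group_def one_BijGroup_UNIV word_prod_Nil)
  next
    case (Cons i "is")
    then have "reflection (\<alpha> i) \<otimes>\<^bsub>BijGroup UNIV\<^esub> word_prod \<alpha> is \<in> weyl_group n \<alpha>"
      unfolding weyl_group_def by (intro generate.eng[OF generate.incl]) auto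
    then show ?case
      by (simp only: mult_BijGroup_UNIV reflection_in_Bij word_prod_in_Bij word_prod_Cons)
  qed
  ultimately show "w \<in> weyl_group n \<alpha>" by simp
qed

lemma coxeter_length_le:
  "set is \<subseteq> {1..n} \<Longrightarrow> coxeter_length n \<alpha> (word_prod \<alpha> is) \<le> length is"
  unfolding coxeter_length_def by (rule Least_le) blast

lemma reduced_word_ex:
  assumes "w \<in> weyl_group n \<alpha>"
  obtains "is" where "set is \<subseteq> {1..n}" "word_prod \<alpha> is = w" "length is = coxeter_length n \<alpha> w"
proof -
  have "\<exists>l is. set is \<subseteq> {1..n} \<and> length is = l \<and> word_prod \<alpha> is = w"
    using assms by (auto simp: weyl_group_eq)
  from LeastI_ex[OF this] show ?thesis
    using that unfolding coxeter_length_def by blast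
qed

section \<open>Positive roots and the exchange condition\<close>

locale based_root_system =
  fixes \<Phi> :: "'a::euclidean_space set" and n :: nat and \<alpha> :: "nat \<Rightarrow> 'a"
  assumes root_system: "root_system \<Phi>"
    and reduced: "reduced_roots \<Phi>"
    and simple: "simple_roots \<Phi> n \<alpha>"
begin

abbreviation height :: "'a \<Rightarrow> real" where
  "height \<equiv> rho_check n \<alpha>"

abbreviation \<omega> :: "nat \<Rightarrow> 'a" where
  "\<omega> \<equiv> fundamental_weight n \<alpha>"

lemma linear_height: "linear height"
  by (rule rho_check_spec(1)[OF simple])

lemma height_simple: "i \<in> {1..n} \<Longrightarrow> height (\<alpha> i) = 1"
  by (rule rho_check_spec(2)[OF simple])

lemma simple_in_roots: "i \<in> {1..n} \<Longrightarrow> \<alpha> i \<in> \<Phi>"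
  using simple by (auto simp: simple_roots_def)

lemma root_nonzero: "\<beta> \<in> \<Phi> \<Longrightarrow> \<beta> \<noteq> 0"
  using root_system by (auto simp: root_system_def)

lemma reflection_root: "\<lbrakk>\<beta> \<in> \<Phi>; \<gamma> \<in> \<Phi>\<rbrakk> \<Longrightarrow> reflection \<beta> \<gamma> \<in> \<Phi>"
  using root_system unfolding root_system_def by blast

lemma word_prod_root: "\<lbrakk>set is \<subseteq> {1..n}; \<beta> \<in> \<Phi>\<rbrakk> \<Longrightarrow> word_prod \<alpha> is \<beta> \<in> \<Phi>"
  by (induction "is") (auto intro!: reflection_root simple_in_roots)

lemma simple_inner_weight:
  assumes "j \<in> {1..n}"
  shows "\<alpha> j \<bullet> \<omega> i = (if i = j then (\<alpha> j \<bullet> \<alpha> j) / 2 else 0)"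
  using fundamental_weight_spec[OF simple assms, of i] root_nonzero[OF simple_in_roots[OF assms]]
  by (auto simp: coroot_def field_simps split: if_splits)

text \<open>Pairing with a fundamental weight reads off one simple coefficient up to a positive
  factor, so signs of coefficients become signs of inner products.\<close>

lemma sum_inner_weight:
  assumes "m \<in> {1..n}"
  shows "(\<Sum>i=1..n. c i *\<^sub>R \<alpha> i) \<bullet> \<omega> m = c m * ((\<alpha> m \<bullet> \<alpha> m) / 2)"
proof -
  have "(\<Sum>i=1..n. c i *\<^sub>R \<alpha> i) \<bullet> \<omega> m = (\<Sum>i=1..n. c i * (\<alpha> i \<bullet> \<omega> m))"
    by (simp add: inner_sum_left)
  also have "\<dots> = (\<Sum>i=1..n. if i = m then c m * ((\<alpha> m \<bullet> \<alpha> m) / 2) else 0)"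
    by (rule sum.cong) (auto simp: simple_inner_weight)
  finally show ?thesis using assms by simp
qed

lemma height_sum: "height (\<Sum>i=1..n. c i *\<^sub>R \<alpha> i) = (\<Sum>i=1..n. c i)"
  by (simp add: linear_sum[OF linear_height] linear_scale[OF linear_height] height_simple)

text \<open>The simple coefficients of a root share one sign and are not all zero, so the sign of
  their sum, the height, decides the sign of every coefficient.\<close>

lemma root_sign_cases:
  assumes "\<beta> \<in> \<Phi>"
  obtains (pos) "height \<beta> > 0" "\<And>m. m \<in> {1..n} \<Longrightarrow> \<beta> \<bullet> \<omega> m \<ge> 0"
    | (neg) "height \<beta> < 0" "\<And>m. m \<in> {1..n} \<Longrightarrow> \<beta> \<bullet> \<omega> m \<le> 0"
proof -
  obtain k :: "nat \<Rightarrow> int" where k: "\<beta> = (\<Sum>i=1..n. of_int (k i) *\<^sub>R \<alpha> i)"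
    and sgn: "(\<forall>i\<in>{1..n}. k i \<ge> 0) \<or> (\<forall>i\<in>{1..n}. k i \<le> 0)"
    using simple assms unfolding simple_roots_def by blast
  have weight: "\<beta> \<bullet> \<omega> m = k m * ((\<alpha> m \<bullet> \<alpha> m) / 2)" if "m \<in> {1..n}" for m
    unfolding k using that by (rule sum_inner_weight)
  have height: "height \<beta> = (\<Sum>i=1..n. real_of_int (k i))"
    unfolding k by (rule height_sum)
  have "\<exists>i\<in>{1..n}. k i \<noteq> 0"
  proof (rule ccontr)
    assume "\<not> ?thesis"
    then have "\<beta> = 0" unfolding k by (intro sum.neutral) auto
    with root_nonzero[OF assms] show False by simp
  qed
  then obtain i where i: "i \<in> {1..n}" "k i \<noteq> 0" by blast
  from sgn show ?thesis
  proof
    assume nonneg: "\<forall>i\<in>{1..n}. k i \<ge> 0"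
    have "height \<beta> > 0" unfolding height
      by (rule sum_pos2[of _ i]) (use i nonneg in force)+
    then show ?thesis
      by (rule pos) (use nonneg in \<open>simp add: weight\<close>)
  next
    assume nonpos: "\<forall>i\<in>{1..n}. k i \<le> 0"
    have "(\<Sum>i=1..n. - real_of_int (k i)) > 0"
      by (rule sum_pos2[of _ i]) (use i nonpos in force)+
    then have "height \<beta> < 0" by (simp add: height sum_negf)
    then show ?thesis
      by (rule neg) (use nonpos in \<open>simp add: weight mult_nonpos_nonneg\<close>)
  qed
qed

text \<open>The reflection in \<alpha> j alters only the j-th coefficient. Reducedness gives \<beta>
  another nonzero coefficient, which is positive and survives, and one positive coefficient makes
  the image a positive root.\<close>

lemma simple_reflection_positive:
  assumes j: "j \<in> {1..n}" and \<beta>: "\<beta> \<in> \<Phi>" "height \<beta> > 0" "\<beta> \<noteq> \<alpha> j"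
  shows "height (reflection (\<alpha> j) \<beta>) > 0"
proof -
  obtain k :: "nat \<Rightarrow> int" where k: "\<beta> = (\<Sum>i=1..n. of_int (k i) *\<^sub>R \<alpha> i)"
    using simple \<beta>(1) unfolding simple_roots_def by blast
  have "\<exists>m\<in>{1..n}. m \<noteq> j \<and> k m \<noteq> 0"
  proof (rule ccontr)
    assume "\<not> ?thesis"
    then have "\<beta> = (\<Sum>i=1..n. if i = j then of_int (k j) *\<^sub>R \<alpha> j else 0)"
      unfolding k by (intro sum.cong) auto
    with j have eq: "\<beta> = of_int (k j) *\<^sub>R \<alpha> j" by simp
    then have "of_int (k j) = (1::real) \<or> of_int (k j) = (-1::real)"
      using reduced simple_in_roots[OF j] \<beta>(1) unfolding reduced_roots_def by blast
    then show False
    proof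
      assume "of_int (k j) = (1::real)"
      with eq \<beta>(3) show False by simp
    next
      assume "of_int (k j) = (-1::real)"
      with eq \<beta>(2) show False
        by (simp add: linear_neg[OF linear_height] height_simple[OF j])
    qed
  qed
  then obtain m where m: "m \<in> {1..n}" "m \<noteq> j" "k m \<noteq> 0" by blast
  have "\<beta> \<bullet> \<omega> m = k m * ((\<alpha> m \<bullet> \<alpha> m) / 2)"
    unfolding k using m(1) by (rule sum_inner_weight)
  then have "\<beta> \<bullet> \<omega> m \<noteq> 0"
    using m(3) root_nonzero[OF simple_in_roots[OF m(1)]] by (metis divide_eq_0_iff inner_eq_zero_iff mult_eq_0_iff of_int_eq_0_iff zero_neq_numeral)
  moreover have "\<beta> \<bullet> \<omega> m \<ge> 0"
    using \<beta>(1) by (cases rule: root_sign_cases) (use \<beta>(2) m(1) in auto)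
  moreover have "reflection (\<alpha> j) \<beta> \<bullet> \<omega> m = \<beta> \<bullet> \<omega> m"
    using m(2) by (simp add: reflection_def inner_diff_left simple_inner_weight[OF j])
  ultimately have pos: "reflection (\<alpha> j) \<beta> \<bullet> \<omega> m > 0" by simp
  have "reflection (\<alpha> j) \<beta> \<in> \<Phi>"
    using simple_in_roots[OF j] \<beta>(1) by (rule reflection_root)
  then show ?thesis
    by (cases rule: root_sign_cases) (use pos m(1) in force)+
qed

text \<open>Allowing every positive root \<beta>, not only simple ones, makes the induction work. As
  the letters of the word act on \<beta> one by one, the root can turn negative only at a letter j
  where it has become \<alpha> j; this is the letter that gets deleted.\<close>

lemma exchange:
  assumes "set is \<subseteq> {1..n}" "\<beta> \<in> \<Phi>" "height \<beta> > 0" "height (word_prod \<alpha> (rev is) \<beta>) < 0"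
  shows "\<exists>js. set js \<subseteq> {1..n} \<and> Suc (length js) = length is \<and>
    reflection \<beta> \<circ> word_prod \<alpha> is = word_prod \<alpha> js"
  using assms
proof (induction "is" arbitrary: \<beta>)
  case Nil
  then show ?case by simp
next
  case (Cons j "is")
  then have j: "j \<in> {1..n}" and "is": "set is \<subseteq> {1..n}" by auto
  show ?case
  proof (cases "\<beta> = \<alpha> j")
    case True
    with "is" show ?thesis by (intro exI[of _ "is"]) (simp add: fun_eq_iff)
  next
    case False
    let ?\<gamma> = "reflection (\<alpha> j) \<beta>"
    have "?\<gamma> \<in> \<Phi>" using simple_in_roots[OF j] Cons.prems(2) by (rule reflection_root)
    moreover have "height ?\<gamma> > 0"
      using simple_reflection_positive[OF j Cons.prems(2,3) False] .
    ultimately obtain js where js: "set js \<subseteq> {1..n}" "Suc (length js) = length is"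
      "reflection ?\<gamma> \<circ> word_prod \<alpha> is = word_prod \<alpha> js"
      using Cons.IH[OF "is", of ?\<gamma>] Cons.prems(4) by (force simp: fun_eq_iff)
    \<comment> \<open>Moving the reflection in \<beta> past the first letter turns it into the
      reflection in \<open>?\<gamma>\<close>, to which the induction hypothesis applies.\<close>
    have "reflection \<beta> (reflection (\<alpha> j) x) = reflection (\<alpha> j) (reflection ?\<gamma> x)" for x
      using reflection_conjugate[of "\<alpha> j" ?\<gamma> x] by simp
    then have "reflection \<beta> \<circ> word_prod \<alpha> (j # is) = word_prod \<alpha> (j # js)"
      using js(3) by (metis comp_apply ext word_prod_Cons)
    with j js(1,2) show ?thesis by (intro exI[of _ "j # js"]) (simp del: word_prod_Cons)
  qed
qed

section \<open>The longest element and antidominant vectors\<close>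

text \<open>Otherwise \<open>?u\<close>, the product of s_i and \<open>?w0\<close>, sends \<alpha> i
  to a negative root under its inverse. Exchange on a reduced word of \<open>?u\<close> then gives a
  strictly shorter word for \<open>?w0\<close>, although \<open>?u\<close> is no longer than
  \<open>?w0\<close>.\<close>

lemma longest_inverse_simple_negative:
  assumes longest: "longest_element n \<alpha> (word_prod \<alpha> is)"
    and "is": "set is \<subseteq> {1..n}" and i: "i \<in> {1..n}"
  shows "height (word_prod \<alpha> (rev is) (\<alpha> i)) < 0"
proof (rule ccontr)
  let ?w0 = "word_prod \<alpha> is" and ?u = "word_prod \<alpha> (i # is)"
  assume nonneg: "\<not> ?thesis"
  have "word_prod \<alpha> (rev is) (\<alpha> i) \<in> \<Phi>"
    using "is" simple_in_roots[OF i] by (intro word_prod_root) auto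
  then have pos: "height (word_prod \<alpha> (rev is) (\<alpha> i)) > 0"
    using nonneg by (cases rule: root_sign_cases) auto
  have "?u \<in> weyl_group n \<alpha>"
    using i "is" unfolding weyl_group_eq by (intro CollectI exI[of _ "i # is"]) auto
  then obtain us where us: "set us \<subseteq> {1..n}" "word_prod \<alpha> us = ?u"
    "length us = coxeter_length n \<alpha> ?u" by (rule reduced_word_ex)
  have "word_prod \<alpha> (rev us) (?u x) = x" for x
    unfolding us(2)[symmetric] by simp
  \<comment> \<open>This vector is chosen because \<open>?u\<close> maps it to s_i (- \<alpha> i) =
    \<alpha> i.\<close>
  from this[of "word_prod \<alpha> (rev is) (- \<alpha> i)"]
  have "word_prod \<alpha> (rev us) (\<alpha> i) = - word_prod \<alpha> (rev is) (\<alpha> i)"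
    using reflection_self[OF root_nonzero[OF simple_in_roots[OF i]]]
    by (simp add: linear_neg[OF linear_word_prod] linear_neg[OF linear_reflection])
  with pos have "height (word_prod \<alpha> (rev us) (\<alpha> i)) < 0"
    by (simp add: linear_neg[OF linear_height])
  then obtain js where js: "set js \<subseteq> {1..n}" "Suc (length js) = length us"
    "reflection (\<alpha> i) \<circ> word_prod \<alpha> us = word_prod \<alpha> js"
    using exchange[OF us(1) simple_in_roots[OF i]] height_simple[OF i] by auto
  have "word_prod \<alpha> js = ?w0"
    by (simp add: us(2) fun_eq_iff flip: js(3))
  then have "coxeter_length n \<alpha> ?w0 \<le> length js"
    using coxeter_length_le[OF js(1), of \<alpha>] by simp
  moreover have "coxeter_length n \<alpha> ?u \<le> coxeter_length n \<alpha> ?w0"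
    using longest \<open>?u \<in> weyl_group n \<alpha>\<close> unfolding longest_element_def by blast
  ultimately show False using js(2) us(3) by simp
qed

lemma negative_root_inner_dominant:
  assumes "\<beta> \<in> \<Phi>" "height \<beta> < 0" "lam \<in> dominant_weights n \<alpha>"
  shows "\<beta> \<bullet> lam \<le> 0"
proof -
  obtain c :: "nat \<Rightarrow> nat" where c: "lam = (\<Sum>i=1..n. of_nat (c i) *\<^sub>R \<omega> i)"
    using assms(3) unfolding dominant_weights_def by blast
  have "\<beta> \<bullet> \<omega> m \<le> 0" if "m \<in> {1..n}" for m
    using assms(1) by (cases rule: root_sign_cases) (use assms(2) that in auto)
  then show ?thesis
    unfolding c inner_sum_right by (intro sum_nonpos) (simp add: mult_nonneg_nonpos)
qed

text \<open>The word need not be reduced: if the prefix \<open>ks\<close> sends \<alpha> j to a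
  negative root, two letters can be deleted without changing the product. This is why the induction
  is on length rather than on prefixes.\<close>

lemma height_antidominant_le:
  assumes anti: "\<And>i. i \<in> {1..n} \<Longrightarrow> \<alpha> i \<bullet> \<mu> \<le> 0" and "set is \<subseteq> {1..n}"
  shows "height \<mu> \<le> height (word_prod \<alpha> is \<mu>)"
  using assms(2)
proof (induction "length is" arbitrary: "is" rule: less_induct)
  case less
  show ?case
  proof (cases "is" rule: rev_exhaust)
    case Nil
    then show ?thesis by simp
  next
    case (snoc ks j)
    with less.prems have j: "j \<in> {1..n}" and ks: "set ks \<subseteq> {1..n}" by auto
    have "word_prod \<alpha> ks (\<alpha> j) \<in> \<Phi>" using ks simple_in_roots[OF j] by (rule word_prod_root)
    then show ?thesis
    proof (cases rule: root_sign_cases)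
      case pos
      have "coroot (\<alpha> j) \<mu> \<le> 0"
        using anti[OF j] by (simp add: coroot_def divide_nonpos_nonneg)
      moreover have "height (word_prod \<alpha> is \<mu>) =
          height (word_prod \<alpha> ks \<mu>) - coroot (\<alpha> j) \<mu> * height (word_prod \<alpha> ks (\<alpha> j))"
        by (simp add: snoc reflection_def linear_diff[OF linear_word_prod]
            linear_scale[OF linear_word_prod] linear_diff[OF linear_height]
            linear_scale[OF linear_height])
      moreover have "height \<mu> \<le> height (word_prod \<alpha> ks \<mu>)"
        using less.hyps[of ks] ks snoc by simp
      ultimately show ?thesis
        using pos(1) mult_nonpos_nonneg[of "coroot (\<alpha> j) \<mu>" "height (word_prod \<alpha> ks (\<alpha> j))"]
        by simp
    next
      case neg
      \<comment> \<open>Exchange deletes letters on the left, so it is applied to the inverse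
        \<open>rev ks\<close>. Inverting the result shows that \<open>rev js\<close> has the same
        product as \<open>is\<close>, with two letters fewer.\<close>
      then obtain js where js: "set js \<subseteq> {1..n}" "Suc (length js) = length ks"
        "reflection (\<alpha> j) \<circ> word_prod \<alpha> (rev ks) = word_prod \<alpha> js"
        using exchange[of "rev ks" "\<alpha> j"] ks simple_in_roots[OF j] height_simple[OF j] by auto
      have "word_prod \<alpha> is x = word_prod \<alpha> (rev js) x" for x
        using word_prod_rev_word_prod[of \<alpha> js "word_prod \<alpha> is x"]
        by (simp add: snoc flip: js(3))
      moreover have "height \<mu> \<le> height (word_prod \<alpha> (rev js) \<mu>)"
        using js snoc by (intro less.hyps) auto
      ultimately show ?thesis by simp
    qed
  qed
qed

end

theorem theorem4p11:
  fixes \<Phi> :: "'a::euclidean_space set"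
    and n :: nat and \<alpha> :: "nat \<Rightarrow> 'a" and lam :: 'a and w w0 :: "'a \<Rightarrow> 'a"
  assumes "root_system \<Phi>" and "crystallographic \<Phi>" and "reduced_roots \<Phi>" and "irreducible_roots \<Phi>"
    and "simple_roots \<Phi> n \<alpha>"
    and "longest_element n \<alpha> w0"
    and "lam \<in> dominant_weights n \<alpha>"
    and "w \<in> weyl_group n \<alpha>"
  shows "atomic_length n \<alpha> lam w \<le> atomic_length n \<alpha> lam w0"
proof -
  interpret based_root_system \<Phi> n \<alpha>
    by unfold_locales (use assms in auto)
  obtain vs where vs: "set vs \<subseteq> {1..n}" "w0 = word_prod \<alpha> vs"
    using assms(6) by (auto simp: longest_element_def weyl_group_eq)
  obtain ws where ws: "set ws \<subseteq> {1..n}" "w = word_prod \<alpha> ws"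
    using assms(8) by (auto simp: weyl_group_eq)
  have "\<alpha> i \<bullet> w0 lam \<le> 0" if i: "i \<in> {1..n}" for i
    unfolding vs(2) inner_word_prod
  proof (rule negative_root_inner_dominant)
    show "word_prod \<alpha> (rev vs) (\<alpha> i) \<in> \<Phi>"
      using vs(1) simple_in_roots[OF i] by (intro word_prod_root) auto
    show "height (word_prod \<alpha> (rev vs) (\<alpha> i)) < 0"
      using assms(6) vs i by (intro longest_inverse_simple_negative) auto
  qed (rule assms(7))
  \<comment> \<open>The word \<open>ws @ rev vs\<close> represents w composed with the inverse of
    w0, which sends \<open>w0 lam\<close> to \<open>w lam\<close>.\<close>
  then have "height (w0 lam) \<le> height (word_prod \<alpha> (ws @ rev vs) (w0 lam))"
    using ws(1) vs(1) by (intro height_antidominant_le) auto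
  then have "height (w0 lam) \<le> height (w lam)"
    by (simp add: vs(2) ws(2))
  then show ?thesis
    by (simp add: atomic_length_def linear_diff[OF linear_height])
qed

end
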